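(* Let $f:\mathbb{Z}^4\to\mathbb{C}$ be a $C^-$ lattice with labelling $\alpha$ and edges $d^i=f_i-f$, and let $p^i=\begin{pmatrix}0&d^i\\-(\alpha^i)^2/d^i&0\end{pmatrix}$. Let $\lambda=e^t\in\mathbb{R}$, let $\Phi$ be the frame with $\Phi_i=(\lambda+\frac1\lambda p^i)\Phi$ and initial value $\Phi(\mathbf{0},t)\in\mathbb{H}$, and let $f_t=\Phi^{-1}\Phi'$, with $'$ the derivative with respect to $t$, be the associated family (so that $f_t(\mathbf{0})\in\mathbb{H}$). Then the points $f_t(x)$ of the diagonal net, $x\in D=\{(i,j,i,j):i,j\in\mathbb{Z}\}$, are quaternions.
   Context: Quaternions are identified with the real subalgebra $\mathbb{H}=\left\{\begin{pmatrix}a&b\\-\bar b&\bar a\end{pmatrix}:a,b\in\mathbb{C}\right\}\subset\mathbb{C}^{2\times2}$. A scalar stands for the corresponding multiple of the identity matrix. For maps on $\mathbb{Z}^4$ write $f=f(x)$, $f_i=f(x+e_i)$, $f_{ij}=f(x+e_i+e_j)$; edge based maps have values $\alpha^i=\alpha^i(x)$ on the edge $(x,x+e_i)$ and $\alpha^i_j=\alpha^i(x+e_j)$. A cross-ratio system is a map $f:\mathbb{Z}^4\to\mathbb{C}$ (with the four points of each quad pairwise distinct) together with an edge labelling $\alpha$ with values in $\mathbb{C}\setminus\{0\}$, $\alpha^i_j=\alpha^i$ for $i\neq j$, such that with $d^i=f_i-f$ one has $\frac{d^id^i_j}{d^jd^j_i}=\frac{(\alpha^i)^2}{(\alpha^j)^2}$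 for $i\ne j$. Its map $s:\mathbb{Z}^4\to\mathbb{C}$ is defined by $s(\mathbf{0})=1$, $d^i=\alpha^is_is$. The cross-ratio system is a $C^-$ lattice if for every $x\in D$: $s_1(x)\bar s_3(x)=1$, $s_2(x)\bar s_4(x)=1$, $\alpha^1(x)=\bar\alpha^3(x)$, $\alpha^2(x)=\bar\alpha^4(x)$. The frame $\Phi$ depends on the vertex and (differentiably) on $t$; as usual for the associated family, $\Phi$ is assumed invertible at the parameters $t$ considered. *)

theory Defs
  imports "HOL-Analysis.Analysis"
begin

text \<open>
  Vertices of the lattice are vectors in \<open>int ^ 4\<close>. The index type \<open>4\<close> has the elements
  \<open>1, 2, 3, 4\<close> (with \<open>4 = 0\<close>), so coordinates carry their usual names. An edge based map \<open>\<alpha>\<close> is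
  written \<open>\<alpha> i x\<close> for its value on the edge from \<open>x\<close> to \<open>x + e i\<close>.
\<close>

abbreviation e :: "4 \<Rightarrow> int ^ 4" where
  "e i \<equiv> axis i 1"

definition quaternions :: "(complex ^ 2 ^ 2) set" where
  "quaternions = {vector [vector [a, b], vector [- cnj b, cnj a]] | a b. True}"

definition diagonal_net :: "(int ^ 4) set" where
  "diagonal_net = {vector [i, j, i, j] | i j. True}"

definition edge :: "(int ^ 4 \<Rightarrow> complex) \<Rightarrow> 4 \<Rightarrow> int ^ 4 \<Rightarrow> complex" where
  "edge f i x = f (x + e i) - f x"

definition edge_labelling :: "(4 \<Rightarrow> int ^ 4 \<Rightarrow> complex) \<Rightarrow> bool" where
  "edge_labelling \<alpha> \<longleftrightarrow>
     (\<forall>i x. \<alpha> i x \<noteq> 0) \<and> (\<forall>i j x. i \<noteq> j \<longrightarrow> \<alpha> i (x + e j) = \<alpha> i x)"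

definition cross_ratio_system ::
  "(int ^ 4 \<Rightarrow> complex) \<Rightarrow> (4 \<Rightarrow> int ^ 4 \<Rightarrow> complex) \<Rightarrow> bool" where
  "cross_ratio_system f \<alpha> \<longleftrightarrow> edge_labelling \<alpha> \<and>
     (\<forall>i j x. i \<noteq> j \<longrightarrow>
        distinct [f x, f (x + e i), f (x + e i + e j), f (x + e j)] \<and>
        (edge f i x * edge f i (x + e j)) / (edge f j x * edge f j (x + e i))
          = (\<alpha> i x)\<^sup>2 / (\<alpha> j x)\<^sup>2)"

text \<open>
  For a cross-ratio system the map \<open>s\<close> exists and is unique, see \<open>ex1_s_map\<close> below.
\<close>

definition s_map ::
  "(int ^ 4 \<Rightarrow> complex) \<Rightarrow> (4 \<Rightarrow> int ^ 4 \<Rightarrow> complex) \<Rightarrow> int ^ 4 \<Rightarrow> complex" where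
  "s_map f \<alpha> = (THE s. s 0 = 1 \<and> (\<forall>i x. edge f i x = \<alpha> i x * s (x + e i) * s x))"

definition C_minus_lattice ::
  "(int ^ 4 \<Rightarrow> complex) \<Rightarrow> (4 \<Rightarrow> int ^ 4 \<Rightarrow> complex) \<Rightarrow> bool" where
  "C_minus_lattice f \<alpha> \<longleftrightarrow> cross_ratio_system f \<alpha> \<and>
     (\<forall>x\<in>diagonal_net.
        s_map f \<alpha> (x + e 1) * cnj (s_map f \<alpha> (x + e 3)) = 1 \<and>
        s_map f \<alpha> (x + e 2) * cnj (s_map f \<alpha> (x + e 4)) = 1 \<and>
        \<alpha> 1 x = cnj (\<alpha> 3 x) \<and> \<alpha> 2 x = cnj (\<alpha> 4 x))"

definition p_matrix ::
  "(int ^ 4 \<Rightarrow> complex) \<Rightarrow> (4 \<Rightarrow> int ^ 4 \<Rightarrow> complex) \<Rightarrow> 4 \<Rightarrow> int ^ 4 \<Rightarrow> complex ^ 2 ^ 2" where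
  "p_matrix f \<alpha> i x =
     vector [vector [0, edge f i x], vector [- ((\<alpha> i x)\<^sup>2 / edge f i x), 0]]"

text \<open>
  The parameter set \<open>T\<close> is there because on all of \<open>\<real>\<close> a frame need not exist: the factor
  \<open>\<lambda> + (1/\<lambda>) p\<^sup>i\<close> is singular when \<open>\<lambda>\<^sup>4 = - (\<alpha>\<^sup>i)\<^sup>2\<close>.
\<close>

definition frame ::
  "(int ^ 4 \<Rightarrow> complex) \<Rightarrow> (4 \<Rightarrow> int ^ 4 \<Rightarrow> complex) \<Rightarrow> real set
     \<Rightarrow> (int ^ 4 \<Rightarrow> real \<Rightarrow> complex ^ 2 ^ 2) \<Rightarrow> bool" where
  "frame f \<alpha> T \<Phi> \<longleftrightarrow>
     (\<forall>x. \<forall>t\<in>T. \<Phi> x differentiable (at t)) \<and>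
     (\<forall>i x. \<forall>t\<in>T.
        \<Phi> (x + e i) t =
          (mat (complex_of_real (exp t)) + (1 / exp t) *\<^sub>R p_matrix f \<alpha> i x) ** \<Phi> x t)"

definition associated_family ::
  "(int ^ 4 \<Rightarrow> real \<Rightarrow> complex ^ 2 ^ 2) \<Rightarrow> real \<Rightarrow> int ^ 4 \<Rightarrow> complex ^ 2 ^ 2" where
  "associated_family \<Phi> t x = matrix_inv (\<Phi> x t) ** vector_derivative (\<Phi> x) (at t)"

lemma int_vec_edge_induct:
  fixes P :: "int ^ 'n \<Rightarrow> bool"
  assumes "P 0" and step: "\<And>x i. P (x + axis i 1) \<longleftrightarrow> P x"
  shows "P x"
proof -
  have "\<forall>x. (\<forall>k. k \<notin> I \<longrightarrow> x $ k = 0) \<longrightarrow> P x" if "finite I" for I :: "'n set"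
    using that
  proof (induction I)
    case empty
    have "x = 0" if "\<forall>k. x $ k = 0" for x :: "int ^ 'n"
      using that by (simp add: vec_eq_iff)
    then show ?case using assms(1) by auto
  next
    case (insert j I)
    have shift: "P (x + axis j n) \<longleftrightarrow> P x" for x :: "int ^ 'n" and n :: int
    proof (induction n rule: int_induct[where k = 0])
      case base
      show ?case by (simp add: axis_eq_0_iff[THEN iffD2])
    next
      case (step1 n)
      have "x + axis j (n + 1) = (x + axis j n) + axis j 1"
        by (simp add: vec_eq_iff axis_def)
      then show ?case using step1 step by metis
    next
      case (step2 n)
      have "x + axis j n = (x + axis j (n - 1)) + axis j 1"
        by (simp add: vec_eq_iff axis_def)
      then show ?case using step2 step by metis
    qed
    show ?case
    proof (intro allI impI)
      fix x :: "int ^ 'n"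
      assume x: "\<forall>k. k \<notin> insert j I \<longrightarrow> x $ k = 0"
      have "P (x + axis j (- (x $ j)))"
        by (rule insert.IH[rule_format]) (use x in \<open>auto simp: axis_def\<close>)
      then show "P x" using shift by blast
    qed
  qed
  from this[of UNIV] show ?thesis by simp
qed

lemma ex_potential_int:
  fixes h :: "int \<Rightarrow> 'a :: field"
  assumes "\<And>n. h n \<noteq> 0"
  shows "\<exists>F. F 0 = 1 \<and> (\<forall>n. F n \<noteq> 0) \<and> (\<forall>n. F (n + 1) = F n * h n)"
proof -
  define F where "F n = (\<Prod>k\<in>{0..<n}. h k) / (\<Prod>k\<in>{n..<0}. h k)" for n
  have "F (n + 1) = F n * h n" for n
  proof (cases "n \<ge> 0")
    case True
    then have "{0..<n + 1} = insert n {0..<n}" by auto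
    with True show ?thesis by (simp add: F_def mult.commute)
  next
    case False
    then have "{n..<0} = insert n {n + 1..<0}" by auto
    with False assms show ?thesis by (simp add: F_def)
  qed
  moreover have "F 0 = 1" "F n \<noteq> 0" for n
    using assms by (auto simp: F_def)
  ultimately show ?thesis by blast
qed

lemma ex_potential_int_vec:
  fixes g :: "'n :: finite \<Rightarrow> int ^ 'n \<Rightarrow> 'a :: field"
  assumes nz: "\<And>i x. g i x \<noteq> 0"
    and closed: "\<And>i j x. g i x * g j (x + axis i 1) = g j x * g i (x + axis j 1)"
  shows "\<exists>v. v 0 = 1 \<and> (\<forall>x. v x \<noteq> 0) \<and> (\<forall>i x. v (x + axis i 1) = v x * g i x)"
proof -
  have "\<exists>v. v 0 = 1 \<and> (\<forall>x. v x \<noteq> 0) \<and>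
          (\<forall>x. (\<forall>k. k \<notin> I \<longrightarrow> x $ k = 0) \<longrightarrow> (\<forall>i\<in>I. v (x + axis i 1) = v x * g i x))"
    if "finite I" for I :: "'n set"
    using that
  proof (induction I)
    case empty
    show ?case by (intro exI[of _ "\<lambda>_. 1"]) auto
  next
    case (insert j I)
    then obtain v where v: "v 0 = 1" "\<And>x. v x \<noteq> 0"
      and vI: "\<And>x i. (\<forall>k. k \<notin> I \<longrightarrow> x $ k = 0) \<Longrightarrow> i \<in> I \<Longrightarrow> v (x + axis i 1) = v x * g i x"
      by blast
    define base :: "int ^ 'n \<Rightarrow> int ^ 'n" where "base x = x - axis j (x $ j)" for x
    have "\<forall>y. \<exists>F. F 0 = 1 \<and> (\<forall>n. F n \<noteq> 0) \<and> (\<forall>n. F (n + 1) = F n * g j (y + axis j n))"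
      by (intro allI ex_potential_int nz)
    then obtain F where F: "\<And>y. F y 0 = 1" "\<And>y n. F y n \<noteq> 0"
      "\<And>y n. F y (n + 1) = F y n * g j (y + axis j n)"
      by metis
    have ax: "y + axis j (n + 1) = y + axis j n + axis j 1" for y :: "int ^ 'n" and n :: int
      by (simp add: vec_eq_iff axis_def)
    have par: "F (y + axis i 1) n * g i y = F y n * g i (y + axis j n)" for y i n
    proof (induction n rule: int_induct[where k = 0])
      case base
      show ?case by (simp add: F axis_eq_0_iff[THEN iffD2])
    next
      case (step1 n)
      have "F (y + axis i 1) (n + 1) * g i y
              = (F (y + axis i 1) n * g i y) * g j (y + axis j n + axis i 1)"
        by (simp only: F(3)) (simp add: add_ac mult_ac)
      also have "\<dots> = F y n * (g i (y + axis j n) * g j (y + axis j n + axis i 1))"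
        by (simp add: step1)
      also have "\<dots> = F y (n + 1) * g i (y + axis j (n + 1))"
        by (simp add: closed F ax)
      finally show ?case .
    next
      case (step2 n)
      let ?z = "y + axis j (n - 1)"
      have z: "y + axis j n = ?z + axis j 1" using ax[of y "n - 1"] by simp
      have "(F (y + axis i 1) (n - 1) * g i y) * g j (?z + axis i 1) = F (y + axis i 1) n * g i y"
        using F(3)[of "y + axis i 1" "n - 1"] by (simp add: add_ac mult_ac)
      also have "\<dots> = F y n * g i (?z + axis j 1)"
        by (simp add: step2 z)
      also have "\<dots> = (F y (n - 1) * g i ?z) * g j (?z + axis i 1)"
        using F(3)[of y "n - 1"] by (simp add: closed mult.assoc)
      finally show ?case using nz by simp
    qed
    define w where "w x = v (base x) * F (base x) (x $ j)" for x
    have "w 0 = 1"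
      by (simp add: w_def base_def v F axis_def flip: zero_vec_def)
    moreover have "w x \<noteq> 0" for x
      by (simp add: w_def v F)
    moreover have "w (x + axis i 1) = w x * g i x"
      if x: "\<forall>k. k \<notin> insert j I \<longrightarrow> x $ k = 0" and i: "i \<in> insert j I" for x i
    proof (cases "i = j")
      case True
      have "base (x + axis j 1) = base x" "base x + axis j (x $ j) = x"
        by (auto simp: base_def vec_eq_iff axis_def)
      with True show ?thesis by (simp add: w_def F axis_def mult.assoc)
    next
      case False
      then have "base (x + axis i 1) = base x + axis i 1" "base x + axis j (x $ j) = x"
        and "(x + axis i 1) $ j = x $ j"
        by (auto simp: base_def vec_eq_iff axis_def)
      moreover have "v (base x + axis i 1) = v (base x) * g i (base x)"
        by (rule vI) (use x i False in \<open>auto simp: base_def axis_def\<close>)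
      ultimately show ?thesis
        using par[of "base x" i "x $ j"] by (simp add: w_def mult_ac)
    qed
    ultimately show ?case by blast
  qed
  from this[of UNIV] show ?thesis by simp blast
qed

lemma cross_ratio_system_edge_nonzero:
  assumes "cross_ratio_system f \<alpha>"
  shows "edge f i x \<noteq> 0"
proof -
  obtain j :: 4 where "i \<noteq> j" by (metis zero_neq_one)
  with assms have "distinct [f x, f (x + e i), f (x + e i + e j), f (x + e j)]"
    unfolding cross_ratio_system_def by blast
  then show ?thesis by (auto simp: edge_def)
qed

lemma ex1_s_map:
  assumes crs: "cross_ratio_system f \<alpha>"
  shows "\<exists>!s. s 0 = 1 \<and> (\<forall>i x. edge f i x = \<alpha> i x * s (x + e i) * s x)"
proof (rule ex_ex1I)
  have a: "\<alpha> i x \<noteq> 0" and ac: "i \<noteq> j \<Longrightarrow> \<alpha> i (x + e j) = \<alpha> i x" for i j x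
    using crs by (auto simp: cross_ratio_system_def edge_labelling_def)
  have d: "edge f i x \<noteq> 0" for i x
    using crs by (rule cross_ratio_system_edge_nonzero)
  define ev :: "int ^ 4 \<Rightarrow> bool" where "ev x = even (\<Sum>k\<in>UNIV. x $ k)" for x
  have "(\<Sum>k\<in>UNIV. (x + e i) $ k) = (\<Sum>k\<in>UNIV. x $ k) + 1" for x i
    by (simp add: sum.distrib axis_def)
  then have ev: "ev (x + e i) \<longleftrightarrow> \<not> ev x" for x i
    by (simp add: ev_def)
  define g where
    "g i x = (if ev x then \<alpha> i x / edge f i x else edge f i x / \<alpha> i x)" for i x
  have "g i x * g j (x + e i) = g j x * g i (x + e j)" for i j x
  proof (cases "i = j")
    case False
    have "(edge f i x * edge f i (x + e j)) / (edge f j x * edge f j (x + e i))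
          = (\<alpha> i x)\<^sup>2 / (\<alpha> j x)\<^sup>2"
      using crs False by (simp add: cross_ratio_system_def)
    then have "edge f i x * edge f i (x + e j) * (\<alpha> j x)\<^sup>2
                 = edge f j x * edge f j (x + e i) * (\<alpha> i x)\<^sup>2"
      using a d by (simp add: field_simps)
    with False a d show ?thesis
      by (auto simp: g_def ev ac field_simps power2_eq_square)
  qed simp
  moreover have "g i x \<noteq> 0" for i x
    using a d by (simp add: g_def)
  ultimately obtain v where v: "v 0 = 1" "\<And>x. v x \<noteq> 0" "\<And>i x. v (x + e i) = v x * g i x"
    using ex_potential_int_vec[of g] by blast
  define s where "s x = (if ev x then v x else 1 / v x)" for x
  have "s 0 = 1"
    by (simp add: s_def v)
  moreover have "edge f i x = \<alpha> i x * s (x + e i) * s x" for i x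
    using a d v(2) by (simp add: s_def ev v(3) g_def field_simps)
  ultimately show "\<exists>s. s 0 = 1 \<and> (\<forall>i x. edge f i x = \<alpha> i x * s (x + e i) * s x)"
    by blast
next
  fix s s'
  assume s: "s 0 = 1 \<and> (\<forall>i x. edge f i x = \<alpha> i x * s (x + e i) * s x)"
    and s': "s' 0 = 1 \<and> (\<forall>i x. edge f i x = \<alpha> i x * s' (x + e i) * s' x)"
  have nz: "\<alpha> i x * s (x + e i) * s x \<noteq> 0" for i x
    using s cross_ratio_system_edge_nonzero[OF crs] by metis
  have eq: "\<alpha> i x * s (x + e i) * s x = \<alpha> i x * s' (x + e i) * s' x" for i x
    using s s' by metis
  have "s x = s' x" for x
  proof (rule int_vec_edge_induct[where P = "\<lambda>x. s x = s' x"])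
    show "s (x + e i) = s' (x + e i) \<longleftrightarrow> s x = s' x" for x i
      using nz[of i x] eq[of i x] by auto
  qed (use s s' in simp)
  then show "s = s'" by blast
qed

end

theory Submission
  imports Defs
begin

text \<open>
  Crossing a diagonal of an \<open>e 1\<close>-\<open>e 3\<close> (or \<open>e 2\<close>-\<open>e 4\<close>) quad based at a point of the diagonal net
  multiplies the frame by a product of two transition matrices. Under the \<open>C\<^sup>-\<close> conditions
  the closing relation of the quad, written in terms of \<open>s\<close>, makes \<open>\<bar>s\<bar>\<close> equal at both ends of the
  diagonal; since \<open>\<bar>s\<bar> = 1\<close> at the origin, the same relation then says that the product is a
  quaternion. Hence the frame is quaternionic on the
  diagonal net for all parameters near \<open>t\<close>, and so are its derivative and the associated family.
\<close>

lemma quaternions_iff: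
  "A \<in> quaternions \<longleftrightarrow> A $ 2 $ 2 = cnj (A $ 1 $ 1) \<and> A $ 2 $ 1 = - cnj (A $ 1 $ 2)"
proof
  assume "A $ 2 $ 2 = cnj (A $ 1 $ 1) \<and> A $ 2 $ 1 = - cnj (A $ 1 $ 2)"
  then have "A = vector [vector [A $ 1 $ 1, A $ 1 $ 2],
      vector [- cnj (A $ 1 $ 2), cnj (A $ 1 $ 1)]]"
    by (simp add: vec_eq_iff forall_2)
  then show "A \<in> quaternions"
    unfolding quaternions_def by blast
qed (auto simp: quaternions_def)

text \<open>The conjugation of \<open>\<complex>\<^bsup>2\<times>2\<^esup> = \<complex> \<otimes> \<H>\<close> with respect to the real form \<open>\<H>\<close>.\<close>

definition quaternion_cnj :: "complex ^ 2 ^ 2 \<Rightarrow> complex ^ 2 ^ 2" where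
  "quaternion_cnj A =
     vector [vector [cnj (A $ 2 $ 2), - cnj (A $ 2 $ 1)], vector [- cnj (A $ 1 $ 2), cnj (A $ 1 $ 1)]]"

lemma quaternions_iff_cnj: "A \<in> quaternions \<longleftrightarrow> quaternion_cnj A = A"
  by (auto simp: quaternions_iff quaternion_cnj_def vec_eq_iff forall_2)

text \<open>The map is entrywise conjugation followed by a similarity with the matrix with rows (0,
  1) and (-1, 0), hence multiplicative.\<close>

lemma quaternion_cnj_mult: "quaternion_cnj (A ** B) = quaternion_cnj A ** quaternion_cnj B"
  by (simp add: quaternion_cnj_def matrix_matrix_mult_def vec_eq_iff forall_2 sum_2)

lemma quaternions_mult: "A \<in> quaternions \<Longrightarrow> B \<in> quaternions \<Longrightarrow> A ** B \<in> quaternions"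
  by (simp add: quaternions_iff_cnj quaternion_cnj_mult)

text \<open>Conjugating the product gives \<open>A ** quaternion_cnj B = A ** B\<close>, and
  \<open>A\<close> cancels. This replaces closure under inverses, both for walking a diagonal
  backwards and for the factor \<open>\<Phi>\<close> inverse in the associated family.\<close>

lemma quaternions_cancel:
  assumes "A \<in> quaternions" "invertible A" "A ** B \<in> quaternions"
  shows "B \<in> quaternions"
proof -
  have "A ** quaternion_cnj B = A ** B"
    using assms by (simp add: quaternions_iff_cnj quaternion_cnj_mult)
  moreover obtain A' where "A' ** A = mat 1"
    using assms(2) by (auto simp: invertible_def)
  ultimately show ?thesis
    by (metis matrix_mul_assoc matrix_mul_lid quaternions_iff_cnj)
qed

lemma quaternions_subspace: "subspace quaternions"
  by (auto simp: subspace_def quaternions_iff)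

text \<open>The difference quotients lie in \<open>V\<close>, which is closed because the space is
  finite-dimensional. The filter \<open>nhds t\<close> also covers \<open>t\<close> itself, so that
  \<open>g t\<close> is in \<open>V\<close>.\<close>

lemma has_vector_derivative_in_subspace:
  fixes g :: "real \<Rightarrow> 'a :: euclidean_space"
  assumes V: "subspace V" and g: "(g has_vector_derivative g') (at t)"
    and ev: "eventually (\<lambda>\<tau>. g \<tau> \<in> V) (nhds t)"
  shows "g' \<in> V"
proof -
  have "((\<lambda>\<tau>. norm (g \<tau> - g t - (\<tau> - t) *\<^sub>R g') / norm (\<tau> - t)) \<longlongrightarrow> 0) (at t)"
    using g by (simp add: has_vector_derivative_def has_derivative_iff_norm)
  moreover have "eventually (\<lambda>\<tau>. norm (g \<tau> - g t - (\<tau> - t) *\<^sub>R g') / norm (\<tau> - t)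
      = norm ((g \<tau> - g t) /\<^sub>R (\<tau> - t) - g')) (at t)"
  proof (rule eventually_at_filter[THEN iffD2], intro always_eventually allI impI)
    fix \<tau> assume "\<tau> \<noteq> t"
    then have "g \<tau> - g t - (\<tau> - t) *\<^sub>R g' = (\<tau> - t) *\<^sub>R ((g \<tau> - g t) /\<^sub>R (\<tau> - t) - g')"
      by (simp add: scaleR_diff_right)
    with \<open>\<tau> \<noteq> t\<close> show "norm (g \<tau> - g t - (\<tau> - t) *\<^sub>R g') / norm (\<tau> - t)
        = norm ((g \<tau> - g t) /\<^sub>R (\<tau> - t) - g')"
      by simp
  qed
  ultimately have "((\<lambda>\<tau>. norm ((g \<tau> - g t) /\<^sub>R (\<tau> - t) - g')) \<longlongrightarrow> 0) (at t)"
    by (rule Lim_transform_eventually)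
  then have "((\<lambda>\<tau>. (g \<tau> - g t) /\<^sub>R (\<tau> - t)) \<longlongrightarrow> g') (at t)"
    using tendsto_norm_zero_iff LIM_zero_iff by blast
  moreover have "eventually (\<lambda>\<tau>. (g \<tau> - g t) /\<^sub>R (\<tau> - t) \<in> V) (at t)"
    using ev eventually_nhds_x_imp_x[OF ev] unfolding eventually_at_filter
    by (auto elim!: eventually_mono intro: subspace_scale[OF V] subspace_diff[OF V])
  ultimately show ?thesis
    by (rule Lim_in_closed_set[OF closed_subspace[OF V] _ trivial_limit_at, rotated])
qed

text \<open>The product has diagonal l^2 - r^2 d' q, l^2 - r^2 q' d and off-diagonal entries l r (d
  + d'), - l r (q + q'). The two assumptions are the quaternion conditions on these pairs.\<close>

lemma quaternions_transition:
  fixes l r :: real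
  assumes "cnj (d' * q) = q' * d" "cnj (d + d') = q + q'"
  shows "(mat (complex_of_real l) + r *\<^sub>R vector [vector [0, d'], vector [- q', 0]]) **
         (mat (complex_of_real l) + r *\<^sub>R vector [vector [0, d], vector [- q, 0]]) \<in> quaternions"
proof -
  have "cnj (d + d') * (of_real l * of_real r) = (q + q') * (of_real l * of_real r)"
    using assms(2) by simp
  with assms(1) show ?thesis
    by (simp add: quaternions_iff matrix_matrix_mult_def sum_2 mat_def
        scaleR_conv_of_real[where 'a = complex] algebra_simps)
qed

lemma cross_ratio_system_s_map:
  assumes "cross_ratio_system f \<alpha>"
  shows "s_map f \<alpha> 0 = 1" "edge f i x = \<alpha> i x * s_map f \<alpha> (x + e i) * s_map f \<alpha> x"
  using theI'[OF ex1_s_map[OF assms]] unfolding s_map_def by blast+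

text \<open>The two edge paths from \<open>f x\<close> to the opposite vertex have the same sum. The
  second claim holds since its left side times \<open>s x\<close> is the difference of the distinct
  points \<open>f (x + e j)\<close> and \<open>f (x + e i)\<close>.\<close>

lemma cross_ratio_quad_closing:
  assumes crs: "cross_ratio_system f \<alpha>" and ij: "i \<noteq> j"
  defines "s \<equiv> s_map f \<alpha>"
  shows "s (x + e i + e j) * (\<alpha> j x * s (x + e i) - \<alpha> i x * s (x + e j))
         = s x * (\<alpha> j x * s (x + e j) - \<alpha> i x * s (x + e i))"
    and "\<alpha> j x * s (x + e j) - \<alpha> i x * s (x + e i) \<noteq> 0"
proof -
  have lab: "\<alpha> i (x + e j) = \<alpha> i x" "\<alpha> j (x + e i) = \<alpha> j x"
    using crs ij by (auto simp: cross_ratio_system_def edge_labelling_def)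
  have comm: "x + e j + e i = x + e i + e j"
    by (simp add: add_ac)
  note E = cross_ratio_system_s_map(2)[OF crs, folded s_def, unfolded edge_def]
  have d: "f (x + e i) - f x = \<alpha> i x * s (x + e i) * s x"
    "f (x + e j) - f x = \<alpha> j x * s (x + e j) * s x"
    "f (x + e i + e j) - f (x + e i) = \<alpha> j x * s (x + e i + e j) * s (x + e i)"
    "f (x + e i + e j) - f (x + e j) = \<alpha> i x * s (x + e i + e j) * s (x + e j)"
    using E[of x i] E[of x j] E[of "x + e i" j] E[of "x + e j" i] by (simp_all add: lab comm)
  then show "s (x + e i + e j) * (\<alpha> j x * s (x + e i) - \<alpha> i x * s (x + e j))
         = s x * (\<alpha> j x * s (x + e j) - \<alpha> i x * s (x + e i))"
    by algebra
  have "f (x + e i) \<noteq> f (x + e j)"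
    using crs ij by (force simp: cross_ratio_system_def)
  then show "\<alpha> j x * s (x + e j) - \<alpha> i x * s (x + e i) \<noteq> 0"
    using d(1,2) by (metis diff_eq_eq eq_iff_diff_eq_0)
qed

text \<open>Conjugation swaps \<open>a\<close> with \<open>c\<close> and \<open>s1\<close> with
  \<open>1 / s3\<close>, so it turns one bracket into minus the other up to the factor
  \<open>s1 * s3\<close>, which has norm 1. Equal nonzero norms then cancel.\<close>

lemma conjugate_quad_norm:
  fixes a c s s1 s3 s13 :: complex
  assumes "s13 * (c * s1 - a * s3) = s * (c * s3 - a * s1)" "c * s3 - a * s1 \<noteq> 0"
    and "cnj a = c" "s1 * cnj s3 = 1"
  shows "norm s13 = norm s"
proof -
  have s: "s1 \<noteq> 0" "s3 \<noteq> 0" "cnj s3 = 1 / s1"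
    using assms(4) by (auto simp: eq_divide_eq mult.commute)
  have s1: "cnj s1 = 1 / s3"
    by (metis s(3) complex_cnj_cnj complex_cnj_divide complex_cnj_one divide_divide_eq_right
        div_by_1 mult_1)
  have a: "cnj c = a"
    using assms(3) by auto
  have "cnj (c * s3 - a * s1) * (s1 * s3) = - (c * s1 - a * s3)"
    using s by (simp add: s1 a assms(3) field_simps)
  moreover have "norm (s1 * s3) = 1"
    by (metis assms(4) complex_mod_cnj norm_mult norm_one)
  ultimately have "norm (c * s3 - a * s1) = norm (c * s1 - a * s3)"
    by (metis complex_mod_cnj mult.right_neutral norm_minus_cancel norm_mult)
  then show ?thesis
    using assms(1,2) by (metis mult_cancel_right norm_eq_zero norm_mult)
qed

text \<open>Provides the assumptions of \<open>quaternions_transition\<close> with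
  \<open>q = a\<^sup>2 / d\<close> and \<open>q' = c\<^sup>2 / d'\<close>. All conjugates become
  rational expressions: \<open>s\<close> and \<open>s13\<close> are unimodular, and
  \<open>cnj s1 = 1 / s3\<close>.\<close>

lemma conjugate_quad_edges:
  fixes a c s s1 s3 s13 :: complex
  assumes closing: "s13 * (c * s1 - a * s3) = s * (c * s3 - a * s1)"
    and "cnj a = c" "s1 * cnj s3 = 1" "norm s = 1" "norm s13 = 1" "a \<noteq> 0"
  defines "d \<equiv> a * s1 * s" and "d' \<equiv> c * s13 * s1"
  shows "cnj (d' * (a\<^sup>2 / d)) = c\<^sup>2 / d' * d" "cnj (d + d') = a\<^sup>2 / d + c\<^sup>2 / d'"
proof -
  have nz: "s1 \<noteq> 0" "s3 \<noteq> 0" "s \<noteq> 0" "s13 \<noteq> 0" "c \<noteq> 0"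
    using assms by auto
  have c3: "cnj s3 = 1 / s1"
    using assms(3) nz by (simp add: eq_divide_eq mult.commute)
  have c1: "cnj s1 = 1 / s3"
    by (metis c3 complex_cnj_cnj complex_cnj_divide complex_cnj_one divide_divide_eq_right
        div_by_1 mult_1)
  have cs: "cnj s = 1 / s" "cnj s13 = 1 / s13"
    using assms(4,5) nz complex_norm_square[of s] complex_norm_square[of s13]
    by (simp_all add: field_simps)
  have ca: "cnj c = a"
    using assms(2) by auto
  show "cnj (d' * (a\<^sup>2 / d)) = c\<^sup>2 / d' * d"
    using nz assms(6) by (simp add: d_def d'_def assms(2) ca cs c1 field_simps power2_eq_square)
  \<comment> \<open>The closing relation sorted by \<open>s1\<close> and \<open>s3\<close>; dividing
    by \<open>s * s13 * s1 * s3\<close> yields the claim.\<close>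
  have "(c * s13 + a * s) * s1 = (a * s13 + c * s) * s3"
    using closing by algebra
  then show "cnj (d + d') = a\<^sup>2 / d + c\<^sup>2 / d'"
    using nz assms(6) by (simp add: d_def d'_def assms(2) ca cs c1 divide_simps power2_eq_square)
qed

text \<open>The determinant is continuous at \<open>t\<close>. Invertibility is given at
  \<open>t\<close> only, while differentiation needs a neighbourhood.\<close>

lemma frame_invertible_nhds:
  assumes "frame f \<alpha> T \<Phi>" "t \<in> T" "invertible (\<Phi> x t)"
  shows "eventually (\<lambda>\<tau>. invertible (\<Phi> x \<tau>)) (nhds t)"
proof -
  have "isCont (\<Phi> x) t"
    using assms(1,2) by (auto simp: frame_def intro: differentiable_imp_continuous_within)
  then have "isCont (\<lambda>\<tau>. det (\<Phi> x \<tau>)) t"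
    unfolding det_2 by (intro continuous_intros)
  then have "eventually (\<lambda>\<tau>. det (\<Phi> x \<tau>) \<noteq> 0) (at t)"
    using assms(3) unfolding invertible_det_nz isCont_def by (rule tendsto_imp_eventually_ne)
  then show ?thesis
    using assms(3) by (auto simp: eventually_at_filter invertible_det_nz elim: eventually_mono)
qed

text \<open>The norm condition travels with the frame condition because the transition product is
  shown quaternionic only where \<open>s\<close> is unimodular. An equivalence allows steps in both
  directions.\<close>

lemma quaternionic_frame_step:
  assumes crs: "cross_ratio_system f \<alpha>" and "open T" and fr: "frame f \<alpha> T \<Phi>" and "t \<in> T"
    and inv: "\<And>x. invertible (\<Phi> x t)" and ij: "i \<noteq> j"
    and ss: "s_map f \<alpha> (x + e i) * cnj (s_map f \<alpha> (x + e j)) = 1"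
    and lab: "\<alpha> i x = cnj (\<alpha> j x)"
  defines "P \<equiv> \<lambda>x. norm (s_map f \<alpha> x) = 1 \<and> eventually (\<lambda>\<tau>. \<Phi> x \<tau> \<in> quaternions) (nhds t)"
  shows "P (x + (e i + e j)) \<longleftrightarrow> P x"
proof -
  define y where "y = x + e i + e j"
  define L where "L \<tau> =
    (mat (complex_of_real (exp \<tau>)) + (1 / exp \<tau>) *\<^sub>R p_matrix f \<alpha> j (x + e i)) **
    (mat (complex_of_real (exp \<tau>)) + (1 / exp \<tau>) *\<^sub>R p_matrix f \<alpha> i x)" for \<tau>
  have a: "\<alpha> i x \<noteq> 0" and lab': "\<alpha> j (x + e i) = \<alpha> j x" and cnj: "cnj (\<alpha> i x) = \<alpha> j x"
    using crs ij lab by (auto simp: cross_ratio_system_def edge_labelling_def)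
  note closing = cross_ratio_quad_closing[OF crs ij, of x]
  have norm: "norm (s_map f \<alpha> y) = norm (s_map f \<alpha> x)"
    unfolding y_def by (rule conjugate_quad_norm[OF closing cnj ss])
  have edges: "edge f i x = \<alpha> i x * s_map f \<alpha> (x + e i) * s_map f \<alpha> x"
    "edge f j (x + e i) = \<alpha> j x * s_map f \<alpha> (x + e i + e j) * s_map f \<alpha> (x + e i)"
    using cross_ratio_system_s_map(2)[OF crs, of i x]
      cross_ratio_system_s_map(2)[OF crs, of j "x + e i"] lab' by simp_all
  have "eventually (\<lambda>\<tau>. \<Phi> y \<tau> \<in> quaternions) (nhds t)
          \<longleftrightarrow> eventually (\<lambda>\<tau>. \<Phi> x \<tau> \<in> quaternions) (nhds t)"
    if "norm (s_map f \<alpha> x) = 1"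
  proof (rule eventually_subst)
    have Lq: "L \<tau> \<in> quaternions" for \<tau>
      unfolding L_def p_matrix_def edges lab'
      by (rule quaternions_transition;
          rule conjugate_quad_edges[OF closing(1) cnj ss that _ a])
        (use norm that in \<open>simp_all add: y_def\<close>)
    have "eventually (\<lambda>\<tau>. invertible (\<Phi> y \<tau>)) (nhds t)"
      by (rule frame_invertible_nhds[OF fr \<open>t \<in> T\<close> inv])
    moreover have "eventually (\<lambda>\<tau>. \<tau> \<in> T) (nhds t)"
      using \<open>open T\<close> \<open>t \<in> T\<close> by (rule eventually_nhds_in_open)
    ultimately show "eventually (\<lambda>\<tau>. (\<Phi> y \<tau> \<in> quaternions) = (\<Phi> x \<tau> \<in> quaternions)) (nhds t)"
    proof eventually_elim
      case (elim \<tau>)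
      then have \<Phi>: "\<Phi> y \<tau> = L \<tau> ** \<Phi> x \<tau>"
        using fr by (simp add: frame_def L_def y_def matrix_mul_assoc)
      \<comment> \<open>A factor of an invertible product; needed to return from \<open>y\<close> to
        \<open>x\<close> by cancellation.\<close>
      with elim have "invertible (L \<tau>)"
        by (simp add: invertible_det_nz det_mul)
      then show ?case
        unfolding \<Phi> using Lq quaternions_mult quaternions_cancel by blast
    qed
  qed
  then show ?thesis
    using norm by (auto simp: P_def y_def add.assoc)
qed

lemma diagonal_net_induct:
  assumes "x \<in> diagonal_net" and "P 0"
    and s13: "\<And>x. x \<in> diagonal_net \<Longrightarrow> P (x + (e 1 + e 3)) \<longleftrightarrow> P x"
    and s24: "\<And>x. x \<in> diagonal_net \<Longrightarrow> P (x + (e 2 + e 4)) \<longleftrightarrow> P x"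
  shows "P x"
proof -
  let ?v = "\<lambda>i j :: int. vector [i, j, i, j] :: int ^ 4"
  have D: "?v i j \<in> diagonal_net" for i j
    unfolding diagonal_net_def by blast
  have v: "?v i j $ 1 = i" "?v i j $ 2 = j" "?v i j $ 3 = i" "?v i j $ 4 = j" for i j
    by (simp_all add: vector_def)
  have v13: "?v (i + 1) j = ?v i j + (e 1 + e 3)" and v24: "?v i (j + 1) = ?v i j + (e 2 + e 4)" for i j
    by (simp_all add: vec_eq_iff forall_4 axis_def v)
  have v0: "?v 0 0 = 0"
    by (simp add: vec_eq_iff forall_4 v)
  have i: "P (?v (i + 1) j) \<longleftrightarrow> P (?v i j)" and j: "P (?v i (j + 1)) \<longleftrightarrow> P (?v i j)" for i j
    unfolding v13 v24 by (rule s13 s24, rule D)+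
  have "P (?v i 0)" for i
    \<comment> \<open>The instance at \<open>_ - 1\<close> serves the downward half of the integer
      induction.\<close>
    by (induction i rule: int_induct[where k = 0])
      (use \<open>P 0\<close> i[of _ 0] i[of "_ - 1" 0] in \<open>simp_all add: v0\<close>)
  then have "P (?v i j)" for i j
    by (induction j rule: int_induct[where k = 0])
      (use j[of i] j[of i "_ - 1"] in simp_all)
  then show ?thesis
    using assms(1) unfolding diagonal_net_def by blast
qed

theorem proposition4p7:
  fixes f :: "int ^ 4 \<Rightarrow> complex"
    and \<alpha> :: "4 \<Rightarrow> int ^ 4 \<Rightarrow> complex"
    and \<Phi> :: "int ^ 4 \<Rightarrow> real \<Rightarrow> complex ^ 2 ^ 2"
    and T :: "real set"
    and t :: real
  assumes "C_minus_lattice f \<alpha>"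
    and "open T"
    and "frame f \<alpha> T \<Phi>"
    and "\<And>\<tau>. \<tau> \<in> T \<Longrightarrow> \<Phi> 0 \<tau> \<in> quaternions"
    and "t \<in> T"
    and "\<And>x. invertible (\<Phi> x t)"
  shows "\<forall>x\<in>diagonal_net. associated_family \<Phi> t x \<in> quaternions"
proof
  fix x
  assume x: "x \<in> diagonal_net"
  define P where
    "P x \<longleftrightarrow> norm (s_map f \<alpha> x) = 1 \<and> eventually (\<lambda>\<tau>. \<Phi> x \<tau> \<in> quaternions) (nhds t)" for x
  have crs: "cross_ratio_system f \<alpha>"
    using assms(1) by (simp add: C_minus_lattice_def)
  note step = quaternionic_frame_step[OF crs assms(2,3,5,6), folded P_def]
  have "eventually (\<lambda>\<tau>. \<tau> \<in> T) (nhds t)"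
    using assms(2,5) by (rule eventually_nhds_in_open)
  then have "P 0"
    using assms(4) by (auto simp: P_def cross_ratio_system_s_map(1)[OF crs] elim: eventually_mono)
  with x have "P x"
    by (rule diagonal_net_induct; intro step)
      (use assms(1) in \<open>auto simp: C_minus_lattice_def\<close>)
  then have q: "eventually (\<lambda>\<tau>. \<Phi> x \<tau> \<in> quaternions) (nhds t)"
    by (simp add: P_def)
  have "(\<Phi> x has_vector_derivative vector_derivative (\<Phi> x) (at t)) (at t)"
    using assms(3,5) by (simp add: frame_def vector_derivative_works)
  then have "vector_derivative (\<Phi> x) (at t) \<in> quaternions"
    using q by (rule has_vector_derivative_in_subspace[OF quaternions_subspace])
  \<comment> \<open>Multiplying the associated family by \<open>\<Phi> x t\<close> recovers the
    quaternionic derivative, so cancellation finishes.\<close>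
  moreover have "\<Phi> x t ** matrix_inv (\<Phi> x t) = mat 1"
    using assms(6)[of x] unfolding invertible_def matrix_inv_def by (rule someI2_ex) blast
  then have "\<Phi> x t ** associated_family \<Phi> t x = vector_derivative (\<Phi> x) (at t)"
    by (simp add: associated_family_def matrix_mul_assoc)
  ultimately show "associated_family \<Phi> t x \<in> quaternions"
    using quaternions_cancel eventually_nhds_x_imp_x[OF q] assms(6) by metis
qed

end
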